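(* Let $h\in L^1(\mathbb{R})$ and $a,b,c,t_0\in\mathbb{R}$. Consider the initial value problem with reflection $$x'(t)+a\,x(-t)+b\,x(t)=h(t)\ \text{ for a.e. } t\in\mathbb{R},\qquad x(t_0)=c. \quad (P)$$ Let $\tilde u:\mathbb{R}\to\mathbb{R}$ be the unique solution of $\tilde u'(t)+a\,\tilde u(-t)+b\,\tilde u(t)=0$ on $\mathbb{R}$ with $\tilde u(0)=1$. Then problem $(P)$ has a unique maximal solution defined on $\mathbb{R}$ (that is, exactly one solution $x:\mathbb{R}\to\mathbb{R}$) if and only if $\tilde u(t_0)\neq 0$.
   Context: A solution is a locally absolutely continuous function $x:\mathbb{R}\to\mathbb{R}$ satisfying the equation almost everywhere, together with the initial condition. Explicitly, with $\omega:=\sqrt{|a^2-b^2|}$: if $a^2>b^2$, $\tilde u(t)=\cos\omega t-\frac{a+b}{\omega}\sin\omega t$; if $a^2<b^2$, $\tilde u(t)=\cosh\omega t-\frac{a+b}{\omega}\sinh\omega t$; if $a=b$, $\tilde u(t)=1-2at$; if $a=-b$, $\tilde u(t)=1$. *)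

theory Defs
  imports "HOL-Analysis.Analysis"
begin

(* Absolute continuity of a function in the epsilon-delta sense; the library constant
   absolutely_continuous is about measures.  Degenerate intervals (p k = q k) are allowed:
   they contribute nothing to either sum. *)
definition abs_cont_on :: "real set \<Rightarrow> (real \<Rightarrow> real) \<Rightarrow> bool" where
  "abs_cont_on S f \<longleftrightarrow>
    (\<forall>\<epsilon>>0. \<exists>\<delta>>0. \<forall>(n::nat) (p::nat \<Rightarrow> real) (q::nat \<Rightarrow> real).
      (\<forall>k<n. p k \<le> q k \<and> {p k..q k} \<subseteq> S) \<longrightarrow>
      disjoint_family_on (\<lambda>k. {p k<..<q k}) {..<n} \<longrightarrow>
      (\<Sum>k<n. q k - p k) < \<delta> \<longrightarrow>
      (\<Sum>k<n. \<bar>f (q k) - f (p k)\<bar>) < \<epsilon>)"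

definition locally_abs_cont :: "(real \<Rightarrow> real) \<Rightarrow> bool" where
  "locally_abs_cont f \<longleftrightarrow> (\<forall>l r. abs_cont_on {l..r} f)"

definition reflection_ivp_solution ::
    "real \<Rightarrow> real \<Rightarrow> (real \<Rightarrow> real) \<Rightarrow> real \<Rightarrow> real \<Rightarrow> (real \<Rightarrow> real) \<Rightarrow> bool" where
  "reflection_ivp_solution a b h t\<^sub>0 c x \<longleftrightarrow>
    locally_abs_cont x \<and>
    (AE t in lebesgue. x differentiable (at t) \<and> deriv x t + a * x (- t) + b * x t = h t) \<and>
    x t\<^sub>0 = c"

definition u_tilde :: "real \<Rightarrow> real \<Rightarrow> real \<Rightarrow> real" where
  "u_tilde a b = (THE u. reflection_ivp_solution a b (\<lambda>_. 0) 0 1 u)"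

end

theory Submission
  imports Defs
begin

text \<open>
  With \<open>y(t) = x(-t)\<close> the homogeneous equation becomes a constant-coefficient planar system, whose
  explicit exponential shows that its solutions are exactly the multiples of \<open>u\<close>. Writing \<open>x = H + w\<close>,
  where \<open>H\<close> is an integral of \<open>h\<close>, turns the inhomogeneous equation into one for a \<open>C\<^sup>1\<close> function \<open>w\<close>
  with continuous forcing, which variation of constants solves. The solutions of the
  inhomogeneous equation therefore form a line \<open>x + r u\<close>, and exactly one of them takes the value \<open>c\<close>
  at \<open>t\<^sub>0\<close> precisely when \<open>u(t\<^sub>0) \<noteq> 0\<close>; if \<open>u(t\<^sub>0) = 0\<close> there are none or infinitely many.
\<close>

subsection \<open>Absolutely continuous functions\<close>

text \<open>The definition indexes its intervals by an initial segment of the naturals; a bijection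
  onto \<open>I\<close> transfers the estimate. Tagged divisions come indexed by pairs of tag and
  interval, and the continuity proof below uses a one-element index type.\<close>

lemma abs_cont_on_finite_families:
  assumes "abs_cont_on S f" and "\<epsilon> > 0"
  shows "\<exists>\<delta>>0. \<forall>I (p::'i \<Rightarrow> real) q. finite I \<longrightarrow> (\<forall>i\<in>I. p i \<le> q i \<and> {p i..q i} \<subseteq> S) \<longrightarrow>
           disjoint_family_on (\<lambda>i. {p i<..<q i}) I \<longrightarrow> (\<Sum>i\<in>I. q i - p i) < \<delta> \<longrightarrow>
           (\<Sum>i\<in>I. \<bar>f (q i) - f (p i)\<bar>) < \<epsilon>"
proof -
  obtain \<delta> where "\<delta> > 0"
    and \<delta>: "\<And>(n::nat) p q. \<lbrakk>\<forall>k<n. p k \<le> q k \<and> {p k..q k} \<subseteq> S;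
              disjoint_family_on (\<lambda>k. {p k<..<q k}) {..<n}; (\<Sum>k<n. q k - p k) < \<delta>\<rbrakk>
            \<Longrightarrow> (\<Sum>k<n. \<bar>f (q k) - f (p k)\<bar>) < \<epsilon>"
    using assms unfolding abs_cont_on_def by meson
  show ?thesis
  proof (intro exI[of _ \<delta>] conjI allI impI)
    fix I and p q :: "'i \<Rightarrow> real"
    assume I: "finite I" and pq: "\<forall>i\<in>I. p i \<le> q i \<and> {p i..q i} \<subseteq> S"
      and disj: "disjoint_family_on (\<lambda>i. {p i<..<q i}) I"
      and less: "(\<Sum>i\<in>I. q i - p i) < \<delta>"
    obtain g where g: "bij_betw g {..<card I} I"
      using ex_bij_betw_nat_finite[OF I] by (auto simp: atLeast0LessThan)
    have gI: "g k \<in> I" if "k < card I" for k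
      using g that by (auto simp: bij_betw_def)
    have "(\<Sum>k<card I. \<bar>f (q (g k)) - f (p (g k))\<bar>) < \<epsilon>"
    proof (rule \<delta>)
      show "\<forall>k<card I. p (g k) \<le> q (g k) \<and> {p (g k)..q (g k)} \<subseteq> S"
        using pq gI by blast
      have inj: "inj_on g {..<card I}"
        using g by (simp add: bij_betw_def)
      show "disjoint_family_on (\<lambda>k. {p (g k)<..<q (g k)}) {..<card I}"
        unfolding disjoint_family_on_def
      proof (intro ballI impI)
        fix m n assume "m \<in> {..<card I}" "n \<in> {..<card I}" "m \<noteq> n"
        then show "{p (g m)<..<q (g m)} \<inter> {p (g n)<..<q (g n)} = {}"
          using gI inj by (intro disjoint_family_onD[OF disj]) (auto dest: inj_onD)
      qed
      show "(\<Sum>k<card I. q (g k) - p (g k)) < \<delta>"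
        using less sum.reindex_bij_betw[OF g, of "\<lambda>i. q i - p i"] by simp
    qed
    then show "(\<Sum>i\<in>I. \<bar>f (q i) - f (p i)\<bar>) < \<epsilon>"
      using sum.reindex_bij_betw[OF g, of "\<lambda>i. \<bar>f (q i) - f (p i)\<bar>"] by simp
  qed (fact \<open>\<delta> > 0\<close>)
qed

text \<open>Additivity followed by monotonicity of the measure. Only the open intervals are assumed
  disjoint, since neighbouring pieces of a division share endpoints.\<close>

lemma sum_disjoint_intervals_le_measure:
  fixes p q :: "'i \<Rightarrow> real"
  assumes "finite I" "\<And>i. i \<in> I \<Longrightarrow> p i \<le> q i" "disjoint_family_on (\<lambda>i. {p i<..<q i}) I"
    and "\<And>i. i \<in> I \<Longrightarrow> {p i<..<q i} \<subseteq> U" "U \<in> lmeasurable"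
  shows "(\<Sum>i\<in>I. q i - p i) \<le> measure lebesgue U"
proof -
  have "(\<Sum>i\<in>I. q i - p i) = (\<Sum>i\<in>I. measure lebesgue {p i<..<q i})"
    using assms(2) by (intro sum.cong) auto
  also have "\<dots> = measure lebesgue (\<Union>i\<in>I. {p i<..<q i})"
    using assms(1-3)
    by (intro measure_finite_Union[symmetric]) auto
  also have "\<dots> \<le> measure lebesgue U"
    using assms by (intro measure_mono_fmeasurable) auto
  finally show ?thesis .
qed

text \<open>
  Gauge argument: take a fine tagged division. Tags outside \<open>N\<close> contribute at most a small multiple
  of the length because the derivative vanishes there; the intervals tagged in \<open>N\<close> lie in an open
  set of small measure, so absolute continuity controls their contribution.
\<close>

lemma abs_cont_on_derivative_zero_imp_eq:
  assumes "l \<le> r" and ac: "abs_cont_on {l..r} f" and N: "negligible N"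
    and der: "\<And>t. t \<in> {l..r} - N \<Longrightarrow> (f has_real_derivative 0) (at t)"
  shows "f r = f l"
proof -
  have "\<bar>f r - f l\<bar> \<le> 0 + e" if "e > 0" for e
  proof -
    obtain \<delta> where "\<delta> > 0"
      and \<delta>: "\<forall>I (p::(real \<times> real set) \<Rightarrow> real) q. finite I \<longrightarrow>
           (\<forall>i\<in>I. p i \<le> q i \<and> {p i..q i} \<subseteq> {l..r}) \<longrightarrow>
           disjoint_family_on (\<lambda>i. {p i<..<q i}) I \<longrightarrow> (\<Sum>i\<in>I. q i - p i) < \<delta> \<longrightarrow>
           (\<Sum>i\<in>I. \<bar>f (q i) - f (p i)\<bar>) < e / 2"
      using abs_cont_on_finite_families[OF ac half_gt_zero[OF \<open>e > 0\<close>]] by blast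
    have NL: "N \<in> sets lebesgue"
      using N negligible_iff_null_sets by blast
    obtain U where U: "open U" "N \<subseteq> U" "U - N \<in> lmeasurable" "emeasure lebesgue (U - N) < ennreal \<delta>"
      using sets_lebesgue_outer_open[OF NL \<open>\<delta> > 0\<close>] by blast
    have "U = (U - N) \<union> N"
      using U by blast
    moreover have "N \<in> lmeasurable"
      using N negligible_imp_measurable by blast
    ultimately have Um: "U \<in> lmeasurable"
      using U(3) fmeasurable.Un by metis
    have "measure lebesgue U = measure lebesgue (U - N)"
      using N Um by (simp add: measure_Diff_null_set negligible_iff_null_sets)
    then have U\<delta>: "measure lebesgue U < \<delta>"
      using U(3,4) \<open>\<delta> > 0\<close> by (simp add: emeasure_eq_measure2 ennreal_less_iff)
    \<comment> \<open>This slope makes \<open>e1 * (r - l)\<close> at most \<open>e / 2\<close>; the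
      added 1 keeps the denominator positive when \<open>l = r\<close>.\<close>
    define e1 where "e1 = e / (2 * (r - l + 1))"
    have "e1 > 0" 
      using \<open>e > 0\<close> \<open>l \<le> r\<close> by (simp add: e1_def)
    have "\<exists>d>0. \<forall>y. \<bar>y - t\<bar> < d \<longrightarrow> \<bar>f y - f t\<bar> \<le> e1 * \<bar>y - t\<bar>" if "t \<in> {l..r} - N" for t
    proof -
      have "(f has_derivative (\<lambda>x. 0)) (at t)"
        using der[OF that] by (simp add: has_field_derivative_def fun_eq_iff[THEN iffD2, of "(*) 0" "\<lambda>x. 0::real"])
      then show ?thesis
        using \<open>e1 > 0\<close> unfolding has_derivative_at_alt by auto
    qed
    then obtain d where d: "\<And>t. t \<in> {l..r} - N \<Longrightarrow> d t > 0"
      "\<And>t y. \<lbrakk>t \<in> {l..r} - N; \<bar>y - t\<bar> < d t\<rbrakk> \<Longrightarrow> \<bar>f y - f t\<bar> \<le> e1 * \<bar>y - t\<bar>"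
      by metis
    \<comment> \<open>A piece tagged in \<open>N\<close> is forced into \<open>U\<close>, any other
      piece into the ball where \<open>f\<close> has slope at most \<open>e1\<close> around the tag.
      All tags lie in \<open>{l..r}\<close>; the last branch only makes the gauge total.\<close>
    define \<gamma> where "\<gamma> t = (if t \<in> N then U else if t \<in> {l..r} then ball t (d t) else UNIV)" for t
    have "gauge \<gamma>"
      using U(1,2) d(1) by (auto simp: gauge_def \<gamma>_def)
    then obtain D where D: "D tagged_division_of {l..r}" "\<gamma> fine D"
      using fine_division_exists_real by blast
    have fin: "finite D"
      using D(1) by blast
    have K: "\<exists>a b. a \<le> b \<and> K = {a..b} \<and> a \<le> x \<and> x \<le> b \<and> l \<le> a \<and> b \<le> r"
      if xK: "(x, K) \<in> D" for x K
    proof -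
      obtain a b where "K = cbox a b"
        using tagged_division_ofD(4)[OF D(1) xK] by blast
      moreover have "x \<in> K" "K \<subseteq> {l..r}"
        using tagged_division_ofD(2,3)[OF D(1) xK] by auto
      ultimately show ?thesis
        by (intro exI[of _ a] exI[of _ b]) auto
    qed
    define p q :: "real \<times> real set \<Rightarrow> real" where "p i = Inf (snd i)" and "q i = Sup (snd i)" for i
    have pq: "p i \<le> q i \<and> snd i = {p i..q i} \<and> p i \<le> fst i \<and> fst i \<le> q i \<and> {p i..q i} \<subseteq> {l..r}"
      if "i \<in> D" for i
    proof -
      obtain a b where "a \<le> b" "snd i = {a..b}" "a \<le> fst i" "fst i \<le> b" "l \<le> a" "b \<le> r"
        using K[of "fst i" "snd i"] \<open>i \<in> D\<close> by auto
      then show ?thesis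
        by (simp add: p_def q_def)
    qed
    have disj: "disjoint_family_on (\<lambda>i. {p i<..<q i}) D"
      unfolding disjoint_family_on_def
    proof (intro ballI impI)
      fix i j assume ij: "i \<in> D" "j \<in> D" "i \<noteq> j"
      then have "interior (snd i) \<inter> interior (snd j) = {}"
        by (intro tagged_division_ofD(5)[OF D(1), of "fst i" _ "fst j"]) (auto simp: prod_eq_iff)
      moreover have "snd i = {p i..q i}" "snd j = {p j..q j}"
        using pq ij by blast+
      ultimately show "{p i<..<q i} \<inter> {p j<..<q j} = {}"
        by simp
    qed
    let ?DN = "{i \<in> D. fst i \<in> N}" and ?DM = "{i \<in> D. fst i \<notin> N}"
    have "f r - f l = (\<Sum>i\<in>D. f (q i) - f (p i))"
      using additive_tagged_division_1[OF \<open>l \<le> r\<close> D(1), of f] by (simp add: p_def q_def case_prod_beta)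
    also have "\<bar>\<dots>\<bar> \<le> (\<Sum>i\<in>D. \<bar>f (q i) - f (p i)\<bar>)"
      by (rule sum_abs)
    also have "\<dots> = (\<Sum>i\<in>?DN \<union> ?DM. \<bar>f (q i) - f (p i)\<bar>)"
      by (rule sum.cong) auto
    also have "\<dots> = (\<Sum>i\<in>?DN. \<bar>f (q i) - f (p i)\<bar>) + (\<Sum>i\<in>?DM. \<bar>f (q i) - f (p i)\<bar>)"
      using fin by (intro sum.union_disjoint) auto
    also have "\<dots> \<le> e / 2 + e / 2"
    proof (rule add_mono)
      have disjN: "disjoint_family_on (\<lambda>i. {p i<..<q i}) ?DN"
        by (rule disjoint_family_on_mono[OF _ disj]) auto
      have "(\<Sum>i\<in>?DN. q i - p i) \<le> measure lebesgue U"
      proof (rule sum_disjoint_intervals_le_measure[OF _ _ disjN _ Um])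
        show "{p i<..<q i} \<subseteq> U" if "i \<in> ?DN" for i
        proof -
          have "snd i \<subseteq> \<gamma> (fst i)"
            using fineD[OF D(2), of "fst i" "snd i"] that by auto
          then show ?thesis
            using pq[of i] that by (auto simp: \<gamma>_def)
        qed
      qed (use fin pq in auto)
      then show "(\<Sum>i\<in>?DN. \<bar>f (q i) - f (p i)\<bar>) \<le> e / 2"
        using U\<delta> fin pq disjN by (intro less_imp_le \<delta>[rule_format]) auto
      have "(\<Sum>i\<in>?DM. \<bar>f (q i) - f (p i)\<bar>) \<le> (\<Sum>i\<in>?DM. e1 * (q i - p i))"
      proof (rule sum_mono)
        fix i assume i: "i \<in> ?DM"
        let ?t = "fst i"
        have t: "?t \<in> {l..r} - N"
          using i pq[of i] by auto
        have "snd i \<subseteq> \<gamma> ?t"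
          using fineD[OF D(2), of "fst i" "snd i"] i by auto
        then have "{p i..q i} \<subseteq> ball ?t (d ?t)"
          using pq[of i] t i by (auto simp: \<gamma>_def split: if_splits)
        then have "p i \<in> ball ?t (d ?t)" "q i \<in> ball ?t (d ?t)"
          using pq[of i] i by (auto simp del: mem_ball intro!: subsetD[of "{p i..q i}" "ball ?t (d ?t)"])
        then have "\<bar>p i - ?t\<bar> < d ?t" "\<bar>q i - ?t\<bar> < d ?t"
          by (auto simp: dist_real_def)
        \<comment> \<open>The tag lies between the endpoints, so the two bounds add up to exactly
          \<open>e1 * (q i - p i)\<close>.\<close>
        then have "\<bar>f (p i) - f ?t\<bar> \<le> e1 * (?t - p i)" "\<bar>f (q i) - f ?t\<bar> \<le> e1 * (q i - ?t)"
          using d(2)[OF t, of "p i"] d(2)[OF t, of "q i"] pq[of i] i by auto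
        then show "\<bar>f (q i) - f (p i)\<bar> \<le> e1 * (q i - p i)"
          by (simp add: algebra_simps)
      qed
      also have "\<dots> \<le> (\<Sum>i\<in>D. e1 * (q i - p i))"
        using fin pq \<open>e1 > 0\<close> by (intro sum_mono2) (auto)
      also have "\<dots> = e1 * (r - l)"
        using additive_tagged_division_1[OF \<open>l \<le> r\<close> D(1), of "\<lambda>x. x"]
        by (simp add: p_def q_def case_prod_beta sum_distrib_left[symmetric])
      also have "\<dots> \<le> e / 2"
        using \<open>e > 0\<close> \<open>l \<le> r\<close> by (simp add: e1_def field_simps)
      finally show "(\<Sum>i\<in>?DM. \<bar>f (q i) - f (p i)\<bar>) \<le> e / 2" .
    qed
    finally show ?thesis by simp
  qed
  then have "\<bar>f r - f l\<bar> \<le> 0"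
    by (rule field_le_epsilon)
  then show ?thesis by simp
qed

section \<open>Closure properties and sources of absolute continuity\<close>

lemma abs_cont_on_add:
  assumes "abs_cont_on S f" "abs_cont_on S g"
  shows "abs_cont_on S (\<lambda>t. f t + g t)"
  unfolding abs_cont_on_def
proof (intro allI impI)
  fix \<epsilon> :: real assume "\<epsilon> > 0"
  obtain d1 where d1: "d1 > 0" "\<forall>(n::nat) p q. (\<forall>k<n. p k \<le> q k \<and> {p k..q k} \<subseteq> S) \<longrightarrow>
      disjoint_family_on (\<lambda>k. {p k<..<q k}) {..<n} \<longrightarrow> (\<Sum>k<n. q k - p k) < d1 \<longrightarrow>
      (\<Sum>k<n. \<bar>f (q k) - f (p k)\<bar>) < \<epsilon> / 2"
    using assms(1) half_gt_zero[OF \<open>\<epsilon> > 0\<close>] unfolding abs_cont_on_def by blast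
  obtain d2 where d2: "d2 > 0" "\<forall>(n::nat) p q. (\<forall>k<n. p k \<le> q k \<and> {p k..q k} \<subseteq> S) \<longrightarrow>
      disjoint_family_on (\<lambda>k. {p k<..<q k}) {..<n} \<longrightarrow> (\<Sum>k<n. q k - p k) < d2 \<longrightarrow>
      (\<Sum>k<n. \<bar>g (q k) - g (p k)\<bar>) < \<epsilon> / 2"
    using assms(2) half_gt_zero[OF \<open>\<epsilon> > 0\<close>] unfolding abs_cont_on_def by blast
  show "\<exists>\<delta>>0. \<forall>(n::nat) p q. (\<forall>k<n. p k \<le> q k \<and> {p k..q k} \<subseteq> S) \<longrightarrow>
      disjoint_family_on (\<lambda>k. {p k<..<q k}) {..<n} \<longrightarrow> (\<Sum>k<n. q k - p k) < \<delta> \<longrightarrow>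
      (\<Sum>k<n. \<bar>f (q k) + g (q k) - (f (p k) + g (p k))\<bar>) < \<epsilon>"
  proof (intro exI[of _ "min d1 d2"] conjI allI impI)
    fix n :: nat and p q :: "nat \<Rightarrow> real"
    assume A: "\<forall>k<n. p k \<le> q k \<and> {p k..q k} \<subseteq> S" "disjoint_family_on (\<lambda>k. {p k<..<q k}) {..<n}"
      "(\<Sum>k<n. q k - p k) < min d1 d2"
    have "(\<Sum>k<n. \<bar>f (q k) + g (q k) - (f (p k) + g (p k))\<bar>)
        \<le> (\<Sum>k<n. \<bar>f (q k) - f (p k)\<bar> + \<bar>g (q k) - g (p k)\<bar>)"
      by (rule sum_mono) linarith
    also have "\<dots> = (\<Sum>k<n. \<bar>f (q k) - f (p k)\<bar>) + (\<Sum>k<n. \<bar>g (q k) - g (p k)\<bar>)"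
      by (rule sum.distrib)
    also have "\<dots> < \<epsilon> / 2 + \<epsilon> / 2"
      using A by (intro add_strict_mono d1(2)[rule_format] d2(2)[rule_format]) auto
    finally show "(\<Sum>k<n. \<bar>f (q k) + g (q k) - (f (p k) + g (p k))\<bar>) < \<epsilon>" by simp
  qed (use d1(1) d2(1) in simp)
qed

lemma lipschitz_imp_abs_cont_on:
  assumes L: "\<And>s t. \<lbrakk>s \<in> S; t \<in> S; s \<le> t\<rbrakk> \<Longrightarrow> \<bar>f t - f s\<bar> \<le> L * (t - s)"
  shows "abs_cont_on S f"
  unfolding abs_cont_on_def
proof (intro allI impI)
  fix \<epsilon> :: real assume "\<epsilon> > 0"
  \<comment> \<open>The constant \<open>L\<close> may be zero or negative;
    \<open>\<bar>L\<bar> + 1\<close> is a positive Lipschitz constant in every case.\<close>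
  define \<delta> where "\<delta> = \<epsilon> / (\<bar>L\<bar> + 1)"
  have "\<delta> > 0" using \<open>\<epsilon> > 0\<close> by (simp add: \<delta>_def)
  show "\<exists>\<delta>>0. \<forall>(n::nat) p q. (\<forall>k<n. p k \<le> q k \<and> {p k..q k} \<subseteq> S) \<longrightarrow>
      disjoint_family_on (\<lambda>k. {p k<..<q k}) {..<n} \<longrightarrow> (\<Sum>k<n. q k - p k) < \<delta> \<longrightarrow>
      (\<Sum>k<n. \<bar>f (q k) - f (p k)\<bar>) < \<epsilon>"
  proof (intro exI[of _ \<delta>] conjI allI impI)
    fix n :: nat and p q :: "nat \<Rightarrow> real"
    assume A: "\<forall>k<n. p k \<le> q k \<and> {p k..q k} \<subseteq> S" "(\<Sum>k<n. q k - p k) < \<delta>"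
    have "(\<Sum>k<n. \<bar>f (q k) - f (p k)\<bar>) \<le> (\<Sum>k<n. (\<bar>L\<bar> + 1) * (q k - p k))"
    proof (rule sum_mono)
      fix k assume "k \<in> {..<n}"
      then have k: "p k \<le> q k" "p k \<in> S" "q k \<in> S"
        using A(1) by (auto simp: subset_iff)
      have "\<bar>f (q k) - f (p k)\<bar> \<le> L * (q k - p k)"
        using L k by blast
      also have "\<dots> \<le> (\<bar>L\<bar> + 1) * (q k - p k)"
        using k(1) by (intro mult_right_mono) auto
      finally show "\<bar>f (q k) - f (p k)\<bar> \<le> (\<bar>L\<bar> + 1) * (q k - p k)" .
    qed
    also have "\<dots> = (\<bar>L\<bar> + 1) * (\<Sum>k<n. q k - p k)"
      by (simp add: sum_distrib_left)
    also have "\<dots> < (\<bar>L\<bar> + 1) * \<delta>"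
      using A(2) by (intro mult_strict_left_mono) auto
    also have "\<dots> = \<epsilon>" by (simp add: \<delta>_def)
    finally show "(\<Sum>k<n. \<bar>f (q k) - f (p k)\<bar>) < \<epsilon>" .
  qed (fact \<open>\<delta> > 0\<close>)
qed

lemma locally_abs_cont_add:
  "\<lbrakk>locally_abs_cont f; locally_abs_cont g\<rbrakk> \<Longrightarrow> locally_abs_cont (\<lambda>t. f t + g t)"
  by (simp add: locally_abs_cont_def abs_cont_on_add)

text \<open>A continuous derivative is bounded on each compact interval, so the mean value theorem
  gives a Lipschitz bound there.\<close>

lemma C1_imp_locally_abs_cont:
  assumes der: "\<And>t. (f has_real_derivative f' t) (at t)" and cont: "continuous_on UNIV f'"
  shows "locally_abs_cont f"
  unfolding locally_abs_cont_def
proof (intro allI)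
  fix l r :: real
  have "compact (f' ` {l..r})"
    by (intro compact_continuous_image continuous_on_subset[OF cont]) auto
  then have "bounded (f' ` {l..r})"
    by (rule compact_imp_bounded)
  then have "\<exists>B. \<forall>t\<in>{l..r}. \<bar>f' t\<bar> \<le> B"
    unfolding bounded_iff by simp
  then obtain B where B: "\<And>t. t \<in> {l..r} \<Longrightarrow> \<bar>f' t\<bar> \<le> B"
    by blast
  show "abs_cont_on {l..r} f"
  proof (rule lipschitz_imp_abs_cont_on)
    fix s t assume st: "s \<in> {l..r}" "t \<in> {l..r}" "s \<le> t"
    show "\<bar>f t - f s\<bar> \<le> B * (t - s)"
    proof (cases "s = t")
      case False
      then obtain z where z: "s < z" "z < t" "f t - f s = (t - s) * f' z"
        using MVT2[of s t f f'] der st by auto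
      then show ?thesis
        using B[of z] st by (simp add: abs_mult mult.commute mult_left_mono)
    qed simp
  qed
qed

lemma locally_abs_cont_scale:
  assumes "locally_abs_cont f"
  shows "locally_abs_cont (\<lambda>t. c * f t)"
  unfolding locally_abs_cont_def abs_cont_on_def
proof (intro allI impI)
  fix l r \<epsilon> :: real assume "\<epsilon> > 0"
  then have "\<epsilon> / (\<bar>c\<bar> + 1) > 0" by simp
  then obtain \<delta> where "\<delta> > 0"
    and \<delta>: "\<And>(n::nat) p q. \<lbrakk>\<forall>k<n. p k \<le> q k \<and> {p k..q k} \<subseteq> {l..r};
              disjoint_family_on (\<lambda>k. {p k<..<q k}) {..<n}; (\<Sum>k<n. q k - p k) < \<delta>\<rbrakk>
            \<Longrightarrow> (\<Sum>k<n. \<bar>f (q k) - f (p k)\<bar>) < \<epsilon> / (\<bar>c\<bar> + 1)"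
    using assms unfolding locally_abs_cont_def abs_cont_on_def by meson
  show "\<exists>\<delta>>0. \<forall>(n::nat) p q. (\<forall>k<n. p k \<le> q k \<and> {p k..q k} \<subseteq> {l..r}) \<longrightarrow>
      disjoint_family_on (\<lambda>k. {p k<..<q k}) {..<n} \<longrightarrow> (\<Sum>k<n. q k - p k) < \<delta> \<longrightarrow>
      (\<Sum>k<n. \<bar>c * f (q k) - c * f (p k)\<bar>) < \<epsilon>"
  proof (intro exI[of _ \<delta>] conjI allI impI)
    fix n :: nat and p q :: "nat \<Rightarrow> real"
    assume A: "\<forall>k<n. p k \<le> q k \<and> {p k..q k} \<subseteq> {l..r}" "disjoint_family_on (\<lambda>k. {p k<..<q k}) {..<n}"
      "(\<Sum>k<n. q k - p k) < \<delta>"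
    have "(\<Sum>k<n. \<bar>c * f (q k) - c * f (p k)\<bar>) = \<bar>c\<bar> * (\<Sum>k<n. \<bar>f (q k) - f (p k)\<bar>)"
      unfolding sum_distrib_left right_diff_distrib[symmetric] abs_mult by (rule refl)
    also have "\<dots> \<le> \<bar>c\<bar> * (\<epsilon> / (\<bar>c\<bar> + 1))"
      by (intro mult_left_mono less_imp_le[OF \<delta>[OF A]]) simp
    also have "\<dots> < \<epsilon>"
    proof -
      have "\<bar>c\<bar> * \<epsilon> < \<epsilon> * (\<bar>c\<bar> + 1)"
        using \<open>\<epsilon> > 0\<close> by (simp add: algebra_simps)
      then show ?thesis
        by (simp add: pos_divide_less_eq)
    qed
    finally show "(\<Sum>k<n. \<bar>c * f (q k) - c * f (p k)\<bar>) < \<epsilon>" .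
  qed (fact \<open>\<delta> > 0\<close>)
qed

lemma locally_abs_cont_imp_continuous:
  assumes "locally_abs_cont f"
  shows "continuous_on UNIV f"
  unfolding continuous_on_iff
proof (intro ballI allI impI)
  fix x \<epsilon> :: real assume "\<epsilon> > 0"
  have ac: "abs_cont_on {x - 1..x + 1} f"
    using assms by (simp add: locally_abs_cont_def)
  obtain \<delta> where "\<delta> > 0"
    and \<delta>: "\<forall>I (p::unit \<Rightarrow> real) q. finite I \<longrightarrow>
           (\<forall>i\<in>I. p i \<le> q i \<and> {p i..q i} \<subseteq> {x - 1..x + 1}) \<longrightarrow>
           disjoint_family_on (\<lambda>i. {p i<..<q i}) I \<longrightarrow> (\<Sum>i\<in>I. q i - p i) < \<delta> \<longrightarrow>
           (\<Sum>i\<in>I. \<bar>f (q i) - f (p i)\<bar>) < \<epsilon>"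
    using abs_cont_on_finite_families[OF ac \<open>\<epsilon> > 0\<close>, where 'i = unit] by blast
  show "\<exists>d>0. \<forall>y\<in>UNIV. dist y x < d \<longrightarrow> dist (f y) (f x) < \<epsilon>"
  \<comment> \<open>The family consists of the single interval between \<open>x\<close> and
    \<open>y\<close>; the cap 1 keeps it inside \<open>{x - 1..x + 1}\<close>.\<close>
  proof (intro exI[of _ "min \<delta> 1"] conjI ballI impI)
    fix y assume "dist y x < min \<delta> 1"
    then show "dist (f y) (f x) < \<epsilon>"
      using \<delta>[rule_format, of "{()}" "\<lambda>_. min x y" "\<lambda>_. max x y"]
      by (cases "x \<le> y") (auto simp: dist_real_def abs_minus_commute disjoint_family_on_def)
  qed (use \<open>\<delta> > 0\<close> in simp)
qed

subsection \<open>Integrals of integrable functions\<close>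

text \<open>The truncated tails tend to 0 pointwise and are dominated by the absolute value of
  \<open>h\<close>, so dominated convergence applies. This serves to split an integrable function
  into a bounded part and a part of small integral.\<close>

lemma integral_tail_small:
  fixes h :: "'a \<Rightarrow> real"
  assumes h: "integrable M h" and "\<epsilon> > 0"
  shows "\<exists>K\<ge>0. (\<integral>x. max 0 (\<bar>h x\<bar> - K) \<partial>M) < \<epsilon>"
proof -
  have "(\<lambda>n. \<integral>x. max 0 (\<bar>h x\<bar> - real n) \<partial>M) \<longlonglongrightarrow> (\<integral>x. 0 \<partial>M)"
  proof (rule integral_dominated_convergence[where w = "\<lambda>x. \<bar>h x\<bar>"])
    show "AE x in M. (\<lambda>n. max 0 (\<bar>h x\<bar> - real n)) \<longlonglongrightarrow> 0"
    proof (rule AE_I2, rule tendsto_eventually)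
      fix x
      obtain N :: nat where "\<bar>h x\<bar> \<le> real N"
        using real_arch_simple by blast
      then show "\<forall>\<^sub>F n in sequentially. max 0 (\<bar>h x\<bar> - real n) = 0"
        by (intro eventually_sequentiallyI[of N]) auto
    qed
  qed (use h in auto)
  then have "\<forall>\<^sub>F n in sequentially. (\<integral>x. max 0 (\<bar>h x\<bar> - real n) \<partial>M) < \<epsilon>"
    using \<open>\<epsilon> > 0\<close> by (intro order_tendstoD(2)) auto
  then obtain n :: nat where "(\<integral>x. max 0 (\<bar>h x\<bar> - real n) \<partial>M) < \<epsilon>"
    using eventually_happens'[OF sequentially_bot] by blast
  then show ?thesis
    by (intro exI[of _ "real n"]) auto
qed

text \<open>Integrating from minus infinity makes sense because \<open>h\<close> is integrable on
  the whole line, and it avoids oriented integrals for negative \<open>t\<close>.\<close>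

definition antiderivative :: "(real \<Rightarrow> real) \<Rightarrow> real \<Rightarrow> real" where
  "antiderivative h t = (LINT s:{..t}|lebesgue. h s)"

text \<open>Endpoints are null sets. The closed form matches the gauge integral used for
  differentiation, the open form the disjoint open intervals of \<open>abs_cont_on\<close>.\<close>

lemma antiderivative_diff:
  assumes h: "integrable lebesgue h" and "p \<le> q"
  shows "antiderivative h q - antiderivative h p = (LINT s:{p..q}|lebesgue. h s)"
    and "antiderivative h q - antiderivative h p = (LINT s:{p<..<q}|lebesgue. h s)"
proof -
  have int: "set_integrable lebesgue A h" if "A \<in> sets lebesgue" for A
    using h that unfolding set_integrable_def by (intro integrable_mult_indicator) auto
  have "antiderivative h q = (LINT s:{..p} \<union> {p<..q}|lebesgue. h s)"
    using \<open>p \<le> q\<close> by (simp add: antiderivative_def ivl_disj_un_one)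
  also have "\<dots> = antiderivative h p + (LINT s:{p<..q}|lebesgue. h s)"
    unfolding antiderivative_def by (intro set_integral_Un int) auto
  finally have *: "antiderivative h q - antiderivative h p = (LINT s:{p<..q}|lebesgue. h s)"
    by simp
  have null: "{a::real} \<in> null_sets lebesgue" for a
    by (simp add: negligible_iff_null_sets[symmetric])
  have "({p<..q} - {p..q}) \<union> ({p..q} - {p<..q}) \<subseteq> {p}"
    by auto
  then have "(LINT s:{p<..q}|lebesgue. h s) = (LINT s:{p..q}|lebesgue. h s)"
    by (intro set_integral_null_delta h) (auto intro: null_sets_completion_subset[OF _ null])
  with * show "antiderivative h q - antiderivative h p = (LINT s:{p..q}|lebesgue. h s)"
    by simp
  have "({p<..q} - {p<..<q}) \<union> ({p<..<q} - {p<..q}) \<subseteq> {q}"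
    by auto
  then have "(LINT s:{p<..q}|lebesgue. h s) = (LINT s:{p<..<q}|lebesgue. h s)"
    by (intro set_integral_null_delta h) (auto intro: null_sets_completion_subset[OF _ null])
  with * show "antiderivative h q - antiderivative h p = (LINT s:{p<..<q}|lebesgue. h s)"
    by simp
qed

text \<open>With \<open>g\<close> the excess of the absolute value of \<open>h\<close> over
  \<open>K\<close>, that absolute value is at most \<open>K + g\<close>. The constant contributes
  \<open>K\<close> times the total length, and \<open>g\<close> contributes at most its integral
  over the whole line, whatever the intervals are.\<close>

lemma abs_cont_on_antiderivative:
  assumes h: "integrable lebesgue h"
  shows "abs_cont_on S (antiderivative h)"
  unfolding abs_cont_on_def
proof (intro allI impI)
  fix \<epsilon> :: real assume "\<epsilon> > 0"
  obtain K where K: "K \<ge> 0" "(\<integral>x. max 0 (\<bar>h x\<bar> - K) \<partial>lebesgue) < \<epsilon> / 2"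
    using integral_tail_small[OF h, of "\<epsilon> / 2"] \<open>\<epsilon> > 0\<close> by auto
  define g where "g x = max 0 (\<bar>h x\<bar> - K)" for x
  have g: "integrable lebesgue g"
  proof (rule Bochner_Integration.integrable_bound[OF h])
    show "g \<in> borel_measurable lebesgue"
      using borel_measurable_integrable[OF h] unfolding g_def by measurable
    show "AE x in lebesgue. norm (g x) \<le> norm (h x)"
      using K(1) by (auto simp: g_def)
  qed
  define \<delta> where "\<delta> = \<epsilon> / (2 * (K + 1))"
  have "\<delta> > 0" using \<open>\<epsilon> > 0\<close> K(1) by (simp add: \<delta>_def)
  show "\<exists>\<delta>>0. \<forall>(n::nat) p q. (\<forall>k<n. p k \<le> q k \<and> {p k..q k} \<subseteq> S) \<longrightarrow>
      disjoint_family_on (\<lambda>k. {p k<..<q k}) {..<n} \<longrightarrow> (\<Sum>k<n. q k - p k) < \<delta> \<longrightarrow>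
      (\<Sum>k<n. \<bar>antiderivative h (q k) - antiderivative h (p k)\<bar>) < \<epsilon>"
  proof (intro exI[of _ \<delta>] conjI allI impI)
    fix n :: nat and p q :: "nat \<Rightarrow> real"
    assume pq: "\<forall>k<n. p k \<le> q k \<and> {p k..q k} \<subseteq> S"
      and disj: "disjoint_family_on (\<lambda>k. {p k<..<q k}) {..<n}"
      and less: "(\<Sum>k<n. q k - p k) < \<delta>"
    let ?I = "\<lambda>k. indicat_real {p k<..<q k}"
    have int: "integrable lebesgue (\<lambda>s. ?I k s * f s)" if "integrable lebesgue f" for k f
      using integrable_mult_indicator[of "{p k<..<q k}" lebesgue f] that by simp
    have intI: "integrable lebesgue (?I k)" for k
      by (rule integrable_real_indicator; cases "p k \<le> q k") auto
    have "(\<Sum>k<n. \<bar>antiderivative h (q k) - antiderivative h (p k)\<bar>)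
        \<le> (\<Sum>k<n. K * (q k - p k) + (\<integral>s. ?I k s * g s \<partial>lebesgue))"
    proof (rule sum_mono)
      fix k assume "k \<in> {..<n}"
      then have k: "p k \<le> q k" using pq by auto
      have "\<bar>antiderivative h (q k) - antiderivative h (p k)\<bar> = \<bar>\<integral>s. ?I k s * h s \<partial>lebesgue\<bar>"
        using antiderivative_diff(2)[OF h k] by (simp add: set_lebesgue_integral_def)
      also have "\<dots> \<le> (\<integral>s. \<bar>?I k s * h s\<bar> \<partial>lebesgue)"
        by (rule integral_abs_bound)
      also have "\<dots> \<le> (\<integral>s. K * ?I k s + ?I k s * g s \<partial>lebesgue)"
      proof (rule integral_mono)
        show "integrable lebesgue (\<lambda>s. \<bar>?I k s * h s\<bar>)"
          by (intro integrable_abs int h)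
        show "integrable lebesgue (\<lambda>s. K * ?I k s + ?I k s * g s)"
          by (intro Bochner_Integration.integrable_add integrable_mult_right int g intI)
      qed (auto simp: g_def indicator_def)
      also have "\<dots> = K * (q k - p k) + (\<integral>s. ?I k s * g s \<partial>lebesgue)"
        using int[OF g] intI k by simp
      finally show "\<bar>antiderivative h (q k) - antiderivative h (p k)\<bar>
          \<le> K * (q k - p k) + (\<integral>s. ?I k s * g s \<partial>lebesgue)" .
    qed
    also have "\<dots> = K * (\<Sum>k<n. q k - p k) + (\<integral>s. (\<Sum>k<n. ?I k s * g s) \<partial>lebesgue)"
      unfolding Bochner_Integration.integral_sum[OF int[OF g]] sum.distrib sum_distrib_left ..
    also have "\<dots> \<le> K * \<delta> + (\<integral>s. g s \<partial>lebesgue)"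
    proof (intro add_mono mult_left_mono integral_mono)
      show "(\<Sum>k<n. ?I k s * g s) \<le> g s" for s
      proof -
        \<comment> \<open>Each point lies in at most one of the disjoint intervals, so
          \<open>g\<close> is counted at most once.\<close>
        have "(\<Sum>k<n. ?I k s) = indicator (\<Union>k<n. {p k<..<q k}) s"
          by (rule indicator_UN_disjoint[OF _ disj, symmetric]) simp
        then have "(\<Sum>k<n. ?I k s) \<le> 1"
          by (simp add: indicator_def)
        then have "(\<Sum>k<n. ?I k s) * g s \<le> 1 * g s"
          by (intro mult_right_mono) (auto simp: g_def)
        then show ?thesis
          by (simp add: sum_distrib_right)
      qed
      show "integrable lebesgue (\<lambda>s. \<Sum>k<n. ?I k s * g s)"
        by (intro Bochner_Integration.integrable_sum int g)
    qed (use less K(1) g in auto)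
    also have "\<dots> < \<epsilon> / 2 + \<epsilon> / 2"
    proof (rule add_le_less_mono)
      show "K * \<delta> \<le> \<epsilon> / 2"
        using K(1) \<open>\<epsilon> > 0\<close> by (simp add: \<delta>_def field_simps)
      show "(\<integral>s. g s \<partial>lebesgue) < \<epsilon> / 2"
        using K(2) by (simp add: g_def)
    qed
    finally show "(\<Sum>k<n. \<bar>antiderivative h (q k) - antiderivative h (p k)\<bar>) < \<epsilon>"
      by simp
  qed (fact \<open>\<delta> > 0\<close>)
qed

section \<open>Lebesgue differentiation of the integral\<close>

text \<open>The differentiation theorem for cubes with a corner at \<open>x\<close>, read in
  dimension one: it gives averages to the right of \<open>x\<close> only.\<close>

lemma right_average_limit:
  fixes f :: "real \<Rightarrow> real"
  assumes "\<And>p q. f integrable_on {p..q}"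
  obtains N where "negligible N"
    "\<And>x e. \<lbrakk>x \<notin> N; 0 < e\<rbrakk> \<Longrightarrow> \<exists>d>0. \<forall>k. 0 < k \<and> k < d \<longrightarrow> \<bar>integral {x..x + k} f / k - f x\<bar> < e"
proof -
  obtain N where N: "negligible N"
    "\<And>x e. \<lbrakk>x \<notin> N; 0 < e\<rbrakk> \<Longrightarrow> \<exists>d>0. \<forall>k. 0 < k \<and> k < d \<longrightarrow>
       norm (integral (cbox x (x + k *\<^sub>R One)) f /\<^sub>R k ^ DIM(real) - f x) < e"
    using integrable_ccontinuous_explicit[of f] assms by (metis box_real(2))
  show thesis
    by (rule that[OF N(1)]) (use N(2) in \<open>simp add: divide_inverse mult.commute\<close>)
qed

lemma antiderivative_has_derivative_AE:
  assumes h: "integrable lebesgue h"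
  obtains N where "negligible N" "\<And>x. x \<notin> N \<Longrightarrow> (antiderivative h has_real_derivative h x) (at x)"
proof -
  let ?H = "antiderivative h" and ?r = "\<lambda>s. h (- s)"
  have set_int: "set_integrable lebesgue {p..q} h" for p q
    using h unfolding set_integrable_def by (intro integrable_mult_indicator) auto
  have int: "h integrable_on {p..q}" for p q
    by (rule set_lebesgue_integral_eq_integral(1)[OF set_int])
  have diff: "?H q - ?H p = integral {p..q} h" if "p \<le> q" for p q
    using antiderivative_diff(1)[OF h that] set_lebesgue_integral_eq_integral(2)[OF set_int] by simp
  obtain N1 where N1: "negligible N1"
    "\<And>x e. \<lbrakk>x \<notin> N1; 0 < e\<rbrakk> \<Longrightarrow> \<exists>d>0. \<forall>k. 0 < k \<and> k < d \<longrightarrow> \<bar>integral {x..x + k} h / k - h x\<bar> < e"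
    using right_average_limit[OF int] by blast
  have "?r integrable_on {p..q}" for p q
    using Henstock_Kurzweil_Integration.integrable_reflect_real[of h "- p" "- q"] int by simp
  then obtain N2 where N2: "negligible N2"
    "\<And>x e. \<lbrakk>x \<notin> N2; 0 < e\<rbrakk> \<Longrightarrow> \<exists>d>0. \<forall>k. 0 < k \<and> k < d \<longrightarrow> \<bar>integral {x..x + k} ?r / k - ?r x\<bar> < e"
    using right_average_limit[of ?r] by blast
  show thesis
  proof (rule that)
    show "negligible (N1 \<union> uminus ` N2)"
      by (intro negligible_Un N1(1) negligible_differentiable_image_negligible[OF order_refl N2(1)]
          linear_imp_differentiable_on linear_uminus)
    fix x assume x: "x \<notin> N1 \<union> uminus ` N2"
    then have x1: "x \<notin> N1" and x2: "- x \<notin> N2"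
      by force+
    show "(?H has_real_derivative h x) (at x)"
      unfolding DERIV_def LIM_eq
    proof (intro allI impI)
      fix e :: real assume "0 < e"
      obtain d1 where d1: "d1 > 0" "\<And>k. \<lbrakk>0 < k; k < d1\<rbrakk> \<Longrightarrow> \<bar>integral {x..x + k} h / k - h x\<bar> < e"
        using N1(2)[OF x1 \<open>0 < e\<close>] by blast
      obtain d2 where d2: "d2 > 0" "\<And>k. \<lbrakk>0 < k; k < d2\<rbrakk> \<Longrightarrow> \<bar>integral {- x..- x + k} ?r / k - h x\<bar> < e"
        using N2(2)[OF x2 \<open>0 < e\<close>] by auto
      show "\<exists>d>0. \<forall>k. k \<noteq> 0 \<and> norm (k - 0) < d \<longrightarrow> norm ((?H (x + k) - ?H x) / k - h x) < e"
      proof (intro exI[of _ "min d1 d2"] conjI allI impI)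
        fix k :: real assume k: "k \<noteq> 0 \<and> norm (k - 0) < min d1 d2"
        show "norm ((?H (x + k) - ?H x) / k - h x) < e"
        proof (cases "k > 0")
          case True
          then show ?thesis
            using d1(2)[of k] diff[of x "x + k"] k by simp
        next
          case False
          have "integral {x + k..x} h = integral {- x..- x + (- k)} ?r"
            using Henstock_Kurzweil_Integration.integral_reflect_real[of "- x + (- k)" "- x" ?r] by (simp add: add.commute)
          then have "(?H (x + k) - ?H x) / k = integral {- x..- x + (- k)} ?r / (- k)"
            using diff[of "x + k" x] False by (simp add: field_simps)
          then show ?thesis
            using d2(2)[of "- k"] False k by simp
        qed
      qed (use d1(1) d2(1) in simp)
    qed
  qed
qed

subsection \<open>The equation with reflection\<close>

lemma continuous_has_antiderivative:
  fixes g :: "real \<Rightarrow> real"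
  assumes "continuous_on UNIV g"
  obtains G where "\<And>t. (G has_real_derivative g t) (at t)"
proof -
  have "\<exists>G. \<forall>t::real. - \<infinity> < ereal t \<longrightarrow> ereal t < \<infinity> \<longrightarrow> (G has_vector_derivative g t) (at t)"
    using assms by (intro einterval_antiderivative) (auto simp: continuous_on_eq_continuous_at)
  then show thesis
    using that by (auto simp: has_real_derivative_iff_has_vector_derivative)
qed

text \<open>Trades the almost-everywhere clause for a null set outside which an actual derivative is
  available; \<open>reflection_ivp_solutionI\<close> goes the other way.\<close>

lemma reflection_ivp_solution_AE:
  assumes "reflection_ivp_solution a b h t\<^sub>0 c x"
  obtains N where "negligible N"
    "\<And>t. t \<notin> N \<Longrightarrow> (x has_real_derivative h t - a * x (- t) - b * x t) (at t)"
proof -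
  have "AE t in lebesgue. x differentiable (at t) \<and> deriv x t + a * x (- t) + b * x t = h t"
    using assms by (simp add: reflection_ivp_solution_def)
  then obtain N where N: "N \<in> null_sets lebesgue"
    "{t. \<not> (x differentiable (at t) \<and> deriv x t + a * x (- t) + b * x t = h t)} \<subseteq> N"
    unfolding eventually_ae_filter by auto
  show thesis
  proof (rule that)
    show "negligible N"
      using N(1) by (simp add: negligible_iff_null_sets)
    fix t assume "t \<notin> N"
    with N(2) have t: "x differentiable (at t)" "deriv x t + a * x (- t) + b * x t = h t"
      by auto
    then have "(x has_real_derivative deriv x t) (at t)"
      by (simp add: DERIV_deriv_iff_real_differentiable)
    moreover have "deriv x t = h t - a * x (- t) - b * x t"
      using t(2) by simp
    ultimately show "(x has_real_derivative h t - a * x (- t) - b * x t) (at t)"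
      by simp
  qed
qed

lemma reflection_ivp_solutionI:
  assumes "locally_abs_cont x" "negligible N" "x t\<^sub>0 = c"
    and der: "\<And>t. t \<notin> N \<Longrightarrow> (x has_real_derivative h t - a * x (- t) - b * x t) (at t)"
  shows "reflection_ivp_solution a b h t\<^sub>0 c x"
proof -
  have "{t. \<not> (x differentiable (at t) \<and> deriv x t + a * x (- t) + b * x t = h t)} \<subseteq> N"
  proof (rule subsetI, rule ccontr)
    fix t assume t: "t \<in> {t. \<not> (x differentiable (at t) \<and> deriv x t + a * x (- t) + b * x t = h t)}"
      and "t \<notin> N"
    from der[OF this(2)] have "x differentiable (at t)" "deriv x t = h t - a * x (- t) - b * x t"
      by (auto simp: real_differentiable_def DERIV_imp_deriv)
    with t show False by simp
  qed
  moreover have "N \<in> null_sets lebesgue"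
    using assms(2) by (simp add: negligible_iff_null_sets)
  ultimately show ?thesis
    using assms(1,3) unfolding reflection_ivp_solution_def eventually_ae_filter by auto
qed

lemma reflection_ivp_solution_diff:
  assumes x: "reflection_ivp_solution a b h t\<^sub>0 c x" and y: "reflection_ivp_solution a b k t\<^sub>0 d y"
  shows "reflection_ivp_solution a b (\<lambda>t. h t - k t) t\<^sub>0 (c - d) (\<lambda>t. x t - y t)"
proof -
  obtain N where N: "negligible N"
    "\<And>t. t \<notin> N \<Longrightarrow> (x has_real_derivative h t - a * x (- t) - b * x t) (at t)"
    using reflection_ivp_solution_AE[OF x] by blast
  obtain M where M: "negligible M"
    "\<And>t. t \<notin> M \<Longrightarrow> (y has_real_derivative k t - a * y (- t) - b * y t) (at t)"
    using reflection_ivp_solution_AE[OF y] by blast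
  show ?thesis
  proof (rule reflection_ivp_solutionI)
    show "negligible (N \<union> M)" using N(1) M(1) by simp
    have "locally_abs_cont (\<lambda>t. x t + (- 1) * y t)"
      using x y by (intro locally_abs_cont_add locally_abs_cont_scale) (auto simp: reflection_ivp_solution_def)
    then show "locally_abs_cont (\<lambda>t. x t - y t)" by simp
    show "x t\<^sub>0 - y t\<^sub>0 = c - d"
      using x y by (simp add: reflection_ivp_solution_def)
    fix t assume "t \<notin> N \<union> M"
    then have "t \<notin> N" "t \<notin> M" by auto
    then show "((\<lambda>t. x t - y t) has_real_derivative h t - k t - a * (x (- t) - y (- t)) - b * (x t - y t)) (at t)"
      using DERIV_diff[OF N(2) M(2)] by (simp add: algebra_simps)
  qed
qed

text \<open>Regularity: \<open>x\<close> is continuous, so the right-hand side is continuous and has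
  an antiderivative \<open>G\<close>. Then \<open>x - G\<close> is locally absolutely continuous
  with derivative 0 almost everywhere, hence constant, and the equation holds at every
  point.\<close>

lemma homogeneous_solution_has_derivative:
  assumes x: "reflection_ivp_solution a b (\<lambda>_. 0) t\<^sub>0 c x"
  shows "(x has_real_derivative - a * x (- t) - b * x t) (at t)"
proof -
  have ac: "locally_abs_cont x"
    using x by (simp add: reflection_ivp_solution_def)
  have cx: "continuous_on UNIV x"
    by (rule locally_abs_cont_imp_continuous[OF ac])
  define g where "g s = - a * x (- s) - b * x s" for s
  have cg: "continuous_on UNIV g"
    unfolding g_def by (intro continuous_intros continuous_on_compose2[OF cx]) auto
  obtain G where G: "\<And>s. (G has_real_derivative g s) (at s)"
    using continuous_has_antiderivative[OF cg] by blast
  obtain N where N: "negligible N" "\<And>s. s \<notin> N \<Longrightarrow> (x has_real_derivative g s) (at s)"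
    using reflection_ivp_solution_AE[OF x] unfolding g_def by auto
  have "locally_abs_cont (\<lambda>s. x s + (- 1) * G s)"
    by (intro locally_abs_cont_add locally_abs_cont_scale ac C1_imp_locally_abs_cont[OF G cg])
  then have "x r - G r = x l - G l" if "l \<le> r" for l r
    using DERIV_diff[OF N(2) G]
    by (intro abs_cont_on_derivative_zero_imp_eq[OF that _ N(1), of "\<lambda>s. x s - G s"])
       (auto simp: locally_abs_cont_def)
  then have "x s - G s = x 0 - G 0" for s
    by (cases "s \<le> 0") (auto simp: not_le less_imp_le)
  then have "x = (\<lambda>s. G s + (x 0 - G 0))"
    by (auto simp: algebra_simps fun_eq_iff)
  moreover have "((\<lambda>s. G s + (x 0 - G 0)) has_real_derivative g t) (at t)"
    using G[of t] by (auto intro!: derivative_eq_intros)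
  ultimately show ?thesis
    unfolding g_def by metis
qed

text \<open>
  The pair \<open>(x(t), x(-t))\<close> solves a linear system with matrix \<open>M = ((-b, -a), (a, b))\<close>, and
  \<open>M\<^sup>2 = (b\<^sup>2 - a\<^sup>2) I\<close>. Hence \<open>exp (t M) = C(t) I + S(t) M\<close> for the following \<open>C\<close> and \<open>S\<close>.
\<close>

locale generalized_trig =
  fixes a b :: real and C S :: "real \<Rightarrow> real"
  assumes dC: "\<And>t. (C has_real_derivative (b\<^sup>2 - a\<^sup>2) * S t) (at t)"
    and dS: "\<And>t. (S has_real_derivative C t) (at t)"
    and C_even: "\<And>t. C (- t) = C t" and S_odd: "\<And>t. S (- t) = - S t"
    and pythagoras: "\<And>t. C t * C t - (b\<^sup>2 - a\<^sup>2) * (S t * S t) = 1"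
    and C0: "C 0 = 1" and S0: "S 0 = 0"

text \<open>Both functions solve \<open>y'' = (b\<^sup>2 - a\<^sup>2) y\<close>; the sign of the
  coefficient decides between the linear, trigonometric and hyperbolic case.\<close>

lemma generalized_trig_exists:
  obtains C S where "generalized_trig a b C S"
proof (cases "b\<^sup>2 - a\<^sup>2" "0::real" rule: linorder_cases)
  case equal
  have "generalized_trig a b (\<lambda>_. 1) (\<lambda>t. t)"
    unfolding generalized_trig_def equal by (auto intro!: derivative_eq_intros)
  then show thesis by (rule that)
next
  case less
  define w where "w = sqrt (a\<^sup>2 - b\<^sup>2)"
  have w: "w > 0" "b\<^sup>2 - a\<^sup>2 = - (w * w)"
    using less by (auto simp: w_def)
  have "cos (w * t) * cos (w * t) + sin (w * t) * sin (w * t) = 1" for t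
    using sin_cos_squared_add2[of "w * t"] by (simp add: power2_eq_square)
  then have "generalized_trig a b (\<lambda>t. cos (w * t)) (\<lambda>t. sin (w * t) / w)"
    unfolding generalized_trig_def w(2)
    using w(1) by (auto intro!: derivative_eq_intros simp: field_simps)
  then show thesis by (rule that)
next
  case greater
  define w where "w = sqrt (b\<^sup>2 - a\<^sup>2)"
  have w: "w > 0" "b\<^sup>2 - a\<^sup>2 = w * w"
    using greater by (auto simp: w_def)
  have "cosh (w * t) * cosh (w * t) - sinh (w * t) * sinh (w * t) = 1" for t
    using hyperbolic_pythagoras[of "w * t"] by (simp add: power2_eq_square)
  then have "generalized_trig a b (\<lambda>t. cosh (w * t)) (\<lambda>t. sinh (w * t) / w)"
    unfolding generalized_trig_def w(2)
    using w(1) by (auto intro!: derivative_eq_intros simp: field_simps)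
  then show thesis by (rule that)
qed

section \<open>Solving the equation with the fundamental matrix\<close>

context generalized_trig
begin

text \<open>This function is the first component of \<open>exp (t M)\<close> applied to
  \<open>(1, 1)\<close>, the initial vector being symmetric since both components agree at
  0.\<close>

lemma homogeneous_solution:
  "((\<lambda>t. C t - (a + b) * S t) has_real_derivative
     - a * (C (- t) - (a + b) * S (- t)) - b * (C t - (a + b) * S t)) (at t)"
  unfolding C_even S_odd
  by (rule DERIV_cong[OF DERIV_diff[OF dC DERIV_cmult[OF dS]]])
     (simp add: algebra_simps power2_eq_square)

lemma particular_solution:
  assumes k: "continuous_on UNIV k"
  obtains w where "\<And>t. (w has_real_derivative k t - a * w (- t) - b * w t) (at t)"
proof -
  \<comment> \<open>\<open>V\<close> is the first component of \<open>\<integral> exp (- s M) (k(s), - k(- s)) ds\<close>; the second is \<open>V(- t)\<close>.\<close>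
  define g where "g t = (C t + b * S t) * k t - a * S t * k (- t)" for t
  have "continuous_on UNIV C" "continuous_on UNIV S"
    using dC dS by (auto intro!: DERIV_continuous_on)
  then have "continuous_on UNIV g"
    unfolding g_def by (intro continuous_intros k continuous_on_compose2[OF k]) auto
  then obtain V where V: "\<And>t. (V has_real_derivative g t) (at t)"
    using continuous_has_antiderivative by blast
  \<comment> \<open>First component of \<open>exp (t M)\<close> applied to
    \<open>(V(t), V(- t))\<close>. The second is \<open>w(- t)\<close> by the parities of
    \<open>C\<close> and \<open>S\<close>, so the system does yield the reflected equation.\<close>
  define w where "w t = (C t - b * S t) * V t - a * S t * V (- t)" for t
  have "(w has_real_derivative k t - a * w (- t) - b * w t) (at t)" for t
  proof -
    have "(w has_real_derivative ((b\<^sup>2 - a\<^sup>2) * S t - b * C t) * V t + (C t - b * S t) * g t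
        - a * C t * V (- t) + a * S t * g (- t)) (at t)"
      unfolding w_def
      by (auto intro!: derivative_eq_intros dC dS V DERIV_mirror[THEN iffD1, OF V])
    also have "((b\<^sup>2 - a\<^sup>2) * S t - b * C t) * V t + (C t - b * S t) * g t
        - a * C t * V (- t) + a * S t * g (- t)
      = k t * (C t * C t - (b\<^sup>2 - a\<^sup>2) * (S t * S t)) - a * w (- t) - b * w t"
      by (simp add: w_def g_def C_even S_odd power2_eq_square algebra_simps)
    finally show ?thesis
      by (simp add: pythagoras)
  qed
  then show thesis by (rule that)
qed

lemma homogeneous_solution_unique:
  assumes x: "\<And>t. (x has_real_derivative - a * x (- t) - b * x t) (at t)"
  shows "x t = x 0 * (C t - (a + b) * S t)"
proof -
  \<comment> \<open>the first component of \<open>exp (- t M) (x(t), x(- t))\<close>\<close>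
  define p where "p t = (C t + b * S t) * x t + a * S t * x (- t)" for t
  have "(p has_real_derivative 0) (at t)" for t
    unfolding p_def
    by (auto intro!: derivative_eq_intros dC dS x DERIV_mirror[THEN iffD1, OF x]
        simp: algebra_simps power2_eq_square)
  then have p: "p t = x 0" for t
    using DERIV_isconst_all[of p t 0] by (simp add: p_def C0 S0)
  \<comment> \<open>Inserting the determinant 1 lets \<open>x\<close> be rewritten as the first
    component of \<open>exp (t M)\<close> applied to \<open>(p(t), p(- t))\<close>, where
    \<open>p\<close> is constantly \<open>x 0\<close>.\<close>
  have "x t = x t * (C t * C t - (b\<^sup>2 - a\<^sup>2) * (S t * S t))"
    by (simp add: pythagoras)
  also have "\<dots> = (C t - b * S t) * p t - a * S t * p (- t)"
    by (simp add: p_def C_even S_odd power2_eq_square algebra_simps)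
  finally show ?thesis
    by (simp add: p algebra_simps)
qed

text \<open>The definite description is legitimate because the initial value problem at 0 has
  exactly one solution: regularity makes every solution differentiable everywhere, and then
  \<open>homogeneous_solution_unique\<close> applies.\<close>

lemma u_tilde_eq: "u_tilde a b t = C t - (a + b) * S t"
proof -
  let ?u = "\<lambda>t. C t - (a + b) * S t"
  have "reflection_ivp_solution a b (\<lambda>_. 0) 0 1 u \<longleftrightarrow> u = ?u" for u
  proof
    assume u: "reflection_ivp_solution a b (\<lambda>_. 0) 0 1 u"
    then have "u 0 = 1" by (simp add: reflection_ivp_solution_def)
    have "u t = ?u t" for t
      using homogeneous_solution_unique[of u t, OF homogeneous_solution_has_derivative[OF u]]
      unfolding \<open>u 0 = 1\<close> by simp
    then show "u = ?u" by (rule ext)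
  next
    assume "u = ?u"
    moreover have "continuous_on UNIV (\<lambda>t. - a * (C (- t) - (a + b) * S (- t)) - b * (C t - (a + b) * S t))"
      using dC dS unfolding C_even S_odd
      by (intro continuous_intros DERIV_continuous_on) auto
    ultimately show "reflection_ivp_solution a b (\<lambda>_. 0) 0 1 u"
      using homogeneous_solution
      by (intro reflection_ivp_solutionI[where N = "{}"])
         (auto intro!: C1_imp_locally_abs_cont simp: C0 S0)
  qed
  then show ?thesis by (simp add: u_tilde_def)
qed

end


section \<open>Existence and uniqueness for the initial value problem\<close>

theorem mainTheorem1:
  fixes h :: "real \<Rightarrow> real" and a b c t\<^sub>0 :: real
  assumes "integrable lebesgue h"
  shows "(\<exists>!x. reflection_ivp_solution a b h t\<^sub>0 c x) \<longleftrightarrow> u_tilde a b t\<^sub>0 \<noteq> 0"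
proof -
  obtain C S where "generalized_trig a b C S"
    by (rule generalized_trig_exists)
  then interpret generalized_trig a b C S .
  define u where "u t = C t - (a + b) * S t" for t
  have u_tilde: "u_tilde a b = u"
    using u_tilde_eq by (auto simp: u_def)
  have u0: "u 0 = 1"
    by (simp add: u_def C0 S0)
  have u': "(u has_real_derivative - a * u (- t) - b * u t) (at t)" for t
    unfolding u_def by (rule homogeneous_solution)
  have homogeneous: "x t = x 0 * u t" if "reflection_ivp_solution a b (\<lambda>_. 0) t\<^sub>0 d x" for d x t
    unfolding u_def by (rule homogeneous_solution_unique[OF homogeneous_solution_has_derivative[OF that]])
  \<comment> \<open>Moving along the line of solutions changes the value at \<open>t\<^sub>0\<close>
    by \<open>r * u t\<^sub>0\<close>. This one fact yields a second solution when
    \<open>u t\<^sub>0\<close> vanishes and adjusts the value to \<open>c\<close> when it does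
    not.\<close>
  have add_u: "reflection_ivp_solution a b h t\<^sub>0 (d + r * u t\<^sub>0) (\<lambda>t. x t + r * u t)"
    if x: "reflection_ivp_solution a b h t\<^sub>0 d x" for d r x
  proof -
    obtain N where N: "negligible N"
      "\<And>t. t \<notin> N \<Longrightarrow> (x has_real_derivative h t - a * x (- t) - b * x t) (at t)"
      using reflection_ivp_solution_AE[OF x] by blast
    have cu: "continuous_on UNIV u"
      using u' by (auto intro!: DERIV_continuous_on)
    have "locally_abs_cont u"
      by (rule C1_imp_locally_abs_cont[OF u'])
         (intro continuous_intros cu continuous_on_compose2[OF cu], auto)
    then have "locally_abs_cont (\<lambda>t. x t + r * u t)"
      using x by (intro locally_abs_cont_add locally_abs_cont_scale) (auto simp: reflection_ivp_solution_def)
    moreover have "((\<lambda>t. x t + r * u t) has_real_derivative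
        h t - a * (x (- t) + r * u (- t)) - b * (x t + r * u t)) (at t)" if "t \<notin> N" for t
      using DERIV_add[OF N(2)[OF that] DERIV_cmult[OF u', of r]] by (simp add: algebra_simps)
    ultimately show ?thesis
      using N(1) x by (intro reflection_ivp_solutionI[where N = N]) (auto simp: reflection_ivp_solution_def)
  qed
  show ?thesis
  proof
    assume ex1: "\<exists>!x. reflection_ivp_solution a b h t\<^sub>0 c x"
    then obtain x where x: "reflection_ivp_solution a b h t\<^sub>0 c x" by blast
    show "u_tilde a b t\<^sub>0 \<noteq> 0"
    proof
      assume "u_tilde a b t\<^sub>0 = 0"
      then have "reflection_ivp_solution a b h t\<^sub>0 c (\<lambda>t. x t + 1 * u t)"
        using add_u[OF x, of 1] by (simp add: u_tilde)
      with ex1 x have "(\<lambda>t. x t + 1 * u t) = x" by blast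
      then have "x 0 + 1 * u 0 = x 0" by metis
      with u0 show False by simp
    qed
  next
    assume ut0: "u_tilde a b t\<^sub>0 \<noteq> 0"
    \<comment> \<open>Substituting \<open>x = H + w\<close> leaves an equation for \<open>w\<close> with a continuous right-hand side.\<close>
    let ?H = "antiderivative h"
    have acH: "locally_abs_cont ?H"
      using abs_cont_on_antiderivative[OF assms] by (simp add: locally_abs_cont_def)
    have cH: "continuous_on UNIV ?H"
      by (rule locally_abs_cont_imp_continuous[OF acH])
    have "continuous_on UNIV (\<lambda>t. - a * ?H (- t) - b * ?H t)"
      by (intro continuous_intros cH continuous_on_compose2[OF cH]) auto
    then obtain w where w: "\<And>t. (w has_real_derivative
        (- a * ?H (- t) - b * ?H t) - a * w (- t) - b * w t) (at t)"
      using particular_solution by blast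
    have cw: "continuous_on UNIV w"
      using w by (auto intro!: DERIV_continuous_on)
    have acw: "locally_abs_cont w"
      by (rule C1_imp_locally_abs_cont[OF w])
         (intro continuous_intros cH cw continuous_on_compose2[OF cH] continuous_on_compose2[OF cw], auto)
    obtain N where N: "negligible N" "\<And>t. t \<notin> N \<Longrightarrow> (?H has_real_derivative h t) (at t)"
      using antiderivative_has_derivative_AE[OF assms] by blast
    have "reflection_ivp_solution a b h t\<^sub>0 (?H t\<^sub>0 + w t\<^sub>0) (\<lambda>t. ?H t + w t)"
    proof (rule reflection_ivp_solutionI[OF _ N(1)])
      show "locally_abs_cont (\<lambda>t. ?H t + w t)"
        by (rule locally_abs_cont_add[OF acH acw])
      fix t assume "t \<notin> N"
      then show "((\<lambda>t. ?H t + w t) has_real_derivative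
          h t - a * (?H (- t) + w (- t)) - b * (?H t + w t)) (at t)"
        using DERIV_add[OF N(2) w, of t] by (simp add: algebra_simps)
    qed simp
    from add_u[OF this, of "(c - (?H t\<^sub>0 + w t\<^sub>0)) / u t\<^sub>0"]
    have "\<exists>x. reflection_ivp_solution a b h t\<^sub>0 c x"
      using ut0 by (auto simp: u_tilde)
    moreover have "x = y"
      if "reflection_ivp_solution a b h t\<^sub>0 c x" "reflection_ivp_solution a b h t\<^sub>0 c y" for x y
    proof -
      \<comment> \<open>The difference is a multiple of \<open>u\<close> that vanishes at
        \<open>t\<^sub>0\<close>; as \<open>u t\<^sub>0\<close> is nonzero, the factor
        \<open>x 0 - y 0\<close> must be 0.\<close>
      have d: "reflection_ivp_solution a b (\<lambda>_. 0) t\<^sub>0 0 (\<lambda>t. x t - y t)"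
        using reflection_ivp_solution_diff[OF that] by simp
      have "x t\<^sub>0 = y t\<^sub>0"
        using that by (simp add: reflection_ivp_solution_def)
      then have "(x 0 - y 0) * u t\<^sub>0 = 0"
        using homogeneous[OF d, of t\<^sub>0] by simp
      then have "x 0 - y 0 = 0"
        using ut0 by (simp add: u_tilde)
      then have "x t - y t = 0" for t
        using homogeneous[OF d, of t] by simp
      then show "x = y" by (simp add: fun_eq_iff)
    qed
    ultimately show "\<exists>!x. reflection_ivp_solution a b h t\<^sub>0 c x"
      by blast
  qed
qed

end
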